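(* For every $n\ge 1$, every generalized Orlicz ball $K\subset\mathbb{R}^n$ of volume $1$ in isotropic position, and every $t>0$, if $X$ is uniformly distributed on $K$, then $$\mathbb{P}\bigg(\bigg|\frac{|X|^2}{n}-L_K^2\bigg|\ge t\bigg)\le\frac{5L_K^4}{nt^2}$$ and $$\mathbb{P}\bigg(\bigg|\frac{|X|}{\sqrt n}-L_K\bigg|\ge t\bigg)\le\frac{5L_K^2}{nt^2}.$$
   Context: A generalized Orlicz ball in $\mathbb{R}^n$ is a set of the form $K=\{x\in\mathbb{R}^n:\sum_{i=1}^n f_i(|x_i|)\le 1\}$, where $f_1,\dots,f_n:[0,\infty)\to[0,\infty)$ (the Young functions) are convex, (strictly) increasing and satisfy $f_i(0)=0$. $K$ of volume $1$ is in isotropic position if, for $X=(X_1,\dots,X_n)$ uniformly distributed on $K$, $\mathbb{E}X_i=0$ and $\mathbb{E}X_iX_j=L_K^2\delta_{ij}$ for all $i,j$, for some constant $L_K>0$; this defines $L_K$. $|\cdot|$ on $\mathbb{R}^n$ is the Euclidean norm. *)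

theory Defs
  imports "HOL-Probability.Probability"
begin

text \<open>
  Young functions live on the half-line; values of \<open>f\<close> at negative arguments are irrelevant,
  since only \<open>f \<bar>x\<bar>\<close> is ever used below.
\<close>

definition young_function :: "(real \<Rightarrow> real) \<Rightarrow> bool" where
  "young_function f \<longleftrightarrow>
     f \<in> {0..} \<rightarrow> {0..} \<and> convex_on {0..} f \<and> strict_mono_on {0..} f \<and> f 0 = 0"

definition generalized_orlicz_ball :: "(real ^ 'n) set \<Rightarrow> bool" where
  "generalized_orlicz_ball K \<longleftrightarrow>
     (\<exists>f :: 'n \<Rightarrow> real \<Rightarrow> real. (\<forall>i. young_function (f i)) \<and>
        K = {x. (\<Sum>i\<in>UNIV. f i \<bar>x $ i\<bar>) \<le> 1})"

definition uniformly_distributed ::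
    "'a measure \<Rightarrow> ('a \<Rightarrow> real ^ 'n) \<Rightarrow> (real ^ 'n) set \<Rightarrow> bool" where
  "uniformly_distributed M X K \<longleftrightarrow>
     X \<in> borel_measurable M \<and> distr M borel X = uniform_measure lborel K"

text \<open>
  The moments are those of the uniform distribution on \<open>K\<close>. No integrability clause is needed:
  a Bochner integral equal to \<open>L\<^sup>2 > 0\<close> forces each squared coordinate to be integrable, hence
  also the coordinates and their products.
\<close>

definition isotropic_with_constant :: "(real ^ 'n) set \<Rightarrow> real \<Rightarrow> bool" where
  "isotropic_with_constant K L \<longleftrightarrow> 0 < L \<and>
     (\<forall>i. (\<integral>x. x $ i \<partial>uniform_measure lborel K) = 0) \<and>
     (\<forall>i j. (\<integral>x. x $ i * x $ j \<partial>uniform_measure lborel K) = (if i = j then L\<^sup>2 else 0))"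

definition isotropic_position :: "(real ^ 'n) set \<Rightarrow> bool" where
  "isotropic_position K \<longleftrightarrow> (\<exists>L. isotropic_with_constant K L)"

definition isotropic_constant :: "(real ^ 'n) set \<Rightarrow> real" where
  "isotropic_constant K = (THE L. isotropic_with_constant K L)"

lemma isotropic_with_constant_unique:
  assumes "isotropic_with_constant K L" and "isotropic_with_constant K L'"
  shows "L = L'"
proof -
  have "L\<^sup>2 = L'\<^sup>2"
    using assms unfolding isotropic_with_constant_def by metis
  moreover have "0 < L" "0 < L'"
    using assms by (simp_all add: isotropic_with_constant_def)
  ultimately show ?thesis
    by (simp add: power2_eq_iff_nonneg)
qed

lemma isotropic_constant_eq:
  assumes "isotropic_with_constant K L"
  shows "isotropic_constant K = L"
  unfolding isotropic_constant_def
  using assms by (blast intro: the_equality isotropic_with_constant_unique)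

end

theory Submission
  imports Defs
begin

text \<open>
  Both estimates come from Chebyshev's inequality for \<open>|X|\<^sup>2\<close>, once its variance is bounded by
  \<open>5 n L\<^sup>4\<close>. Expanding the variance into covariances of the squared coordinates, this bound has two
  sources: the squares of distinct coordinates are negatively correlated, so that the off-diagonal
  terms only help, and each coordinate satisfies \<open>E X\<^sub>i\<^sup>4 \<le> 6 (E X\<^sub>i\<^sup>2)\<^sup>2\<close>, so that a diagonal term is
  at most \<open>5 L\<^sup>4\<close>. The bound for \<open>|X|\<close> itself follows because
  \<open>\<bar>a\<^sup>2 - L\<^sup>2\<bar> = \<bar>a - L\<bar> (a + L) \<ge> \<bar>a - L\<bar> L\<close> for \<open>a \<ge> 0\<close>.

  Both sources rest on one fact (\<open>orlicz_volume_log_concave\<close>): for any set of coordinates \<open>I\<close>, the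
  volume \<open>W(r)\<close> of \<open>{x. (\<Sum>i\<in>I. f\<^sub>i \<bar>x\<^sub>i\<bar>) \<le> r}\<close> is a log-concave function of \<open>r\<close>. It is proved by
  adding one coordinate at a time. Slicing gives \<open>\<integral> W (r - f\<^sub>i \<bar>a\<bar>) da\<close> for the new volume; the
  integrand is log-concave in \<open>(r, a)\<close> jointly because \<open>W\<close> is increasing and log-concave and \<open>f\<^sub>i\<close> is
  convex, and a one-dimensional Prekopa--Leindler inequality shows that integrating out \<open>a\<close> keeps
  log-concavity. Here every slice decreases with \<open>\<bar>a\<bar>\<close>, its superlevel sets are symmetric intervals,
  and the Brunn--Minkowski inequality needed for them is immediate.

  \<^item> Negative correlation (\<open>orlicz_square_negative_correlation\<close>). Up to normalization, the pair
    \<open>(X\<^sub>i, X\<^sub>j)\<close> has density \<open>W (1 - f\<^sub>i \<bar>a\<bar> - f\<^sub>j \<bar>b\<bar>)\<close> with \<open>W\<close> the volume in the remaining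
    coordinates. Log-concavity of \<open>W\<close> implies that pairing two values of \<open>\<bar>a\<bar>\<close> with two
    values of \<open>\<bar>b\<bar>\<close> in the same order gives a smaller product of densities than pairing them in
    opposite orders. Two applications of Chebyshev's association inequality turn this into
    \<open>E X\<^sub>i\<^sup>2 X\<^sub>j\<^sup>2 \<le> E X\<^sub>i\<^sup>2 E X\<^sub>j\<^sup>2\<close>.

  \<^item> Fourth moments (\<open>log_concave_fourth_moment\<close>). The density \<open>W (1 - f\<^sub>i \<bar>a\<bar>)\<close> of \<open>X\<^sub>i\<close> is even and
    log-concave on the half-line. It is compared with the Laplace density of the same variance,
    for which \<open>E Z\<^sup>4 = 6 (E Z\<^sup>2)\<^sup>2\<close>.
\<close>

section \<open>Prekopa--Leindler for symmetric decreasing functions on the line\<close>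

text \<open>
  A set that contains every number of smaller absolute value than one of its members is a symmetric
  interval. Which end points belong to it is irrelevant for its measure, so only the radius is kept.
\<close>

lemma symmetric_interval_radius:
  fixes A :: "real set"
  assumes "0 \<in> A" and "bounded A"
    and sym: "\<And>x y. x \<in> A \<Longrightarrow> \<bar>y\<bar> \<le> \<bar>x\<bar> \<Longrightarrow> y \<in> A"
  obtains a where "0 \<le> a" "A \<subseteq> {-a..a}" "{-a<..<a} \<subseteq> A"
proof
  let ?a = "Sup (abs ` A)"
  obtain R where R: "\<And>x. x \<in> A \<Longrightarrow> \<bar>x\<bar> \<le> R"
    using \<open>bounded A\<close> by (auto simp: bounded_iff)
  then have bdd: "bdd_above (abs ` A)"
    by (auto simp: bdd_above_def)
  have upper: "\<bar>x\<bar> \<le> ?a" if "x \<in> A" for x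
    using that by (intro cSup_upper bdd) auto
  show "0 \<le> ?a"
    using upper[OF \<open>0 \<in> A\<close>] by simp
  show "A \<subseteq> {-?a..?a}"
    using upper by (force simp: abs_le_iff)
  show "{-?a<..<?a} \<subseteq> A"
  proof
    fix y assume "y \<in> {-?a<..<?a}"
    then have "\<bar>y\<bar> < ?a" by auto
    then obtain x where "x \<in> A" "\<bar>y\<bar> < \<bar>x\<bar>"
      using less_cSup_iff[OF _ bdd] \<open>0 \<in> A\<close> by (metis empty_iff imageE image_eqI)
    then show "y \<in> A"
      using sym by force
  qed
qed

text \<open>
  With \<open>a\<close> and \<open>b\<close> the radii of \<open>A\<close> and \<open>B\<close>, the set \<open>C\<close> contains the open interval of radius
  \<open>(1 - l) a + l b\<close>: write one of its points as \<open>k ((1 - l) a + l b)\<close> with \<open>\<bar>k\<bar> < 1\<close> and combine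
  \<open>k a \<in> A\<close> with \<open>k b \<in> B\<close>.
\<close>

lemma brunn_minkowski_symmetric_intervals:
  fixes A B C :: "real set"
  assumes l: "0 \<le> l" "l \<le> 1"
    and A: "0 \<in> A" "bounded A" "\<And>x y. x \<in> A \<Longrightarrow> \<bar>y\<bar> \<le> \<bar>x\<bar> \<Longrightarrow> y \<in> A"
    and B: "0 \<in> B" "bounded B" "\<And>x y. x \<in> B \<Longrightarrow> \<bar>y\<bar> \<le> \<bar>x\<bar> \<Longrightarrow> y \<in> B"
    and C: "C \<in> sets borel" "\<And>x y. x \<in> A \<Longrightarrow> y \<in> B \<Longrightarrow> (1 - l) * x + l * y \<in> C"
  shows "ennreal (1 - l) * emeasure lborel A + ennreal l * emeasure lborel B
    \<le> emeasure lborel C"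
proof -
  obtain a where a: "0 \<le> a" "A \<subseteq> {-a..a}" "{-a<..<a} \<subseteq> A"
    by (rule symmetric_interval_radius[OF A])
  obtain b where b: "0 \<le> b" "B \<subseteq> {-b..b}" "{-b<..<b} \<subseteq> B"
    by (rule symmetric_interval_radius[OF B])
  let ?c = "(1 - l) * a + l * b"
  have c: "0 \<le> ?c" using a b l by simp
  have sub: "{-?c<..<?c} \<subseteq> C"
  proof
    fix z assume "z \<in> {-?c<..<?c}"
    then have z: "\<bar>z\<bar> < ?c" by auto
    define k where "k = z / ?c"
    have "\<bar>k\<bar> < 1" and zk: "z = k * ?c"
      using z by (auto simp: k_def)
    \<comment> \<open>If the radius vanishes, the open interval is empty and only the centre is available.\<close>
    have "k * a \<in> A"
    proof (cases "a = 0")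
      case False
      then have "\<bar>k * a\<bar> < a" using \<open>\<bar>k\<bar> < 1\<close> \<open>0 \<le> a\<close> by (simp add: abs_mult)
      then show ?thesis using a(3) by (auto simp: abs_less_iff)
    qed (use A in simp)
    moreover have "k * b \<in> B"
    proof (cases "b = 0")
      case False
      then have "\<bar>k * b\<bar> < b" using \<open>\<bar>k\<bar> < 1\<close> \<open>0 \<le> b\<close> by (simp add: abs_mult)
      then show ?thesis using b(3) by (auto simp: abs_less_iff)
    qed (use B in simp)
    ultimately have "(1 - l) * (k * a) + l * (k * b) \<in> C" by (rule C)
    then show "z \<in> C"
      unfolding zk by (simp add: algebra_simps)
  qed
  have "emeasure lborel A \<le> emeasure lborel {-a..a}"
    by (rule emeasure_mono) (use a in auto)
  moreover have "emeasure lborel B \<le> emeasure lborel {-b..b}"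
    by (rule emeasure_mono) (use b in auto)
  ultimately have "ennreal (1 - l) * emeasure lborel A + ennreal l * emeasure lborel B
    \<le> ennreal (1 - l) * ennreal (2 * a) + ennreal l * ennreal (2 * b)"
    using a b by (intro add_mono mult_left_mono) auto
  also have "\<dots> = ennreal (?c - (- ?c))"
  proof -
    have "0 \<le> (1 - l) * (2 * a)" "0 \<le> l * (2 * b)" using a b l by auto
    then have "ennreal ((1 - l) * (2 * a) + l * (2 * b)) = ennreal (1 - l) * ennreal (2 * a) + ennreal l * ennreal (2 * b)"
      using l by (simp add: ennreal_mult')
    then show ?thesis by (simp add: algebra_simps)
  qed
  also have "\<dots> = emeasure lborel {-?c<..<?c}"
    by (rule emeasure_lborel_Ioo[symmetric]) (use c in linarith)
  also have "\<dots> \<le> emeasure lborel C"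
    using sub C by (intro emeasure_mono) auto
  finally show ?thesis .
qed

lemma nn_integral_layer_cake:
  fixes f :: "real \<Rightarrow> real"
  assumes [measurable]: "f \<in> borel_measurable borel" and nonneg: "\<And>x. 0 \<le> f x"
  shows "(\<integral>\<^sup>+x. f x \<partial>lborel) = (\<integral>\<^sup>+u. emeasure lborel {x. 0 < u \<and> u < f x} \<partial>lborel)"
proof -
  have "(\<integral>\<^sup>+x. f x \<partial>lborel) = (\<integral>\<^sup>+x. \<integral>\<^sup>+u. indicator {(x, u). 0 < u \<and> u < f x} (x, u) \<partial>lborel \<partial>lborel)"
  proof (rule nn_integral_cong)
    fix x :: real
    have "(\<integral>\<^sup>+u. indicator {(x, u). 0 < u \<and> u < f x} (x, u) \<partial>lborel) = (\<integral>\<^sup>+u. indicator {0<..<f x} u \<partial>lborel)"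
      by (intro nn_integral_cong) (auto simp: indicator_def)
    then show "ennreal (f x) = (\<integral>\<^sup>+u. indicator {(x, u). 0 < u \<and> u < f x} (x, u) \<partial>lborel)"
      using nonneg[of x] by simp
  qed
  also have "\<dots> = (\<integral>\<^sup>+u. \<integral>\<^sup>+x. indicator {(x, u). 0 < u \<and> u < f x} (x, u) \<partial>lborel \<partial>lborel)"
    by (rule lborel_pair.Fubini'[symmetric]) (simp add: split_beta', measurable)
  also have "\<dots> = (\<integral>\<^sup>+u. \<integral>\<^sup>+x. indicator {x. 0 < u \<and> u < f x} x \<partial>lborel \<partial>lborel)"
    by (intro nn_integral_cong) (auto simp: indicator_def)
  also have "\<dots> = (\<integral>\<^sup>+u. emeasure lborel {x. 0 < u \<and> u < f x} \<partial>lborel)"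
    by (intro nn_integral_cong) simp
  finally show ?thesis .
qed

text \<open>
  When both functions have maximum \<open>1\<close>, their superlevel sets at each level \<open>0 < u < 1\<close> are symmetric
  intervals containing the origin, and \<open>h\<close> exceeds \<open>u\<close> on convex combinations of them. Integrating the
  Brunn--Minkowski inequality over all levels gives the claim, even in the stronger form with an
  arithmetic mean of integrals. The normalization makes the two families of superlevel sets nonempty
  for the same range of levels.
\<close>

lemma prekopa_leindler_normalized:
  fixes f g h :: "real \<Rightarrow> real"
  assumes l: "0 \<le> l" "l \<le> 1"
    and [measurable]: "f \<in> borel_measurable borel" "g \<in> borel_measurable borel"
      "h \<in> borel_measurable borel"
    and f: "f 0 = 1" "\<And>x. 0 \<le> f x" "\<And>x y. \<bar>x\<bar> \<le> \<bar>y\<bar> \<Longrightarrow> f y \<le> f x" "bounded {x. f x \<noteq> 0}"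
    and g: "g 0 = 1" "\<And>x. 0 \<le> g x" "\<And>x y. \<bar>x\<bar> \<le> \<bar>y\<bar> \<Longrightarrow> g y \<le> g x" "bounded {x. g x \<noteq> 0}"
    and h: "\<And>x. 0 \<le> h x" "\<And>x y. min (f x) (g y) \<le> h ((1 - l) * x + l * y)"
  shows "ennreal (1 - l) * (\<integral>\<^sup>+x. f x \<partial>lborel) + ennreal l * (\<integral>\<^sup>+x. g x \<partial>lborel)
    \<le> (\<integral>\<^sup>+x. h x \<partial>lborel)"
proof -
  have meas: "(\<lambda>u. emeasure lborel {x. 0 < u \<and> u < k x}) \<in> borel_measurable lborel"
    if [measurable]: "k \<in> borel_measurable borel" for k :: "real \<Rightarrow> real"
    by measurable
  have "ennreal (1 - l) * (\<integral>\<^sup>+x. f x \<partial>lborel) + ennreal l * (\<integral>\<^sup>+x. g x \<partial>lborel)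
    = (\<integral>\<^sup>+u. ennreal (1 - l) * emeasure lborel {x. 0 < u \<and> u < f x}
        + ennreal l * emeasure lborel {x. 0 < u \<and> u < g x} \<partial>lborel)"
    using meas[of f] meas[of g] by (simp add: nn_integral_layer_cake f g nn_integral_add nn_integral_cmult)
  also have "\<dots> \<le> (\<integral>\<^sup>+u. emeasure lborel {x. 0 < u \<and> u < h x} \<partial>lborel)"
  proof (rule nn_integral_mono)
    fix u :: real
    show "ennreal (1 - l) * emeasure lborel {x. 0 < u \<and> u < f x}
        + ennreal l * emeasure lborel {x. 0 < u \<and> u < g x} \<le> emeasure lborel {x. 0 < u \<and> u < h x}"
    proof (cases "0 < u \<and> u < 1")
      case True
      show ?thesis
      proof (rule brunn_minkowski_symmetric_intervals[OF l])
        show "bounded {x. 0 < u \<and> u < f x}" "bounded {x. 0 < u \<and> u < g x}"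
          by (rule bounded_subset[OF f(4)], use True in auto)
          (rule bounded_subset[OF g(4)], use True in auto)
        show "(1 - l) * x + l * y \<in> {x. 0 < u \<and> u < h x}"
          if "x \<in> {x. 0 < u \<and> u < f x}" "y \<in> {x. 0 < u \<and> u < g x}" for x y
          using that h(2)[of x y] by auto
      qed (use True f g in \<open>auto intro: less_le_trans\<close>)
    next
      case False
      moreover have "f x \<le> 1" "g x \<le> 1" for x
        using f(3)[of 0 x] g(3)[of 0 x] f(1) g(1) by auto
      ultimately have "\<not> (0 < u \<and> u < f x)" "\<not> (0 < u \<and> u < g x)" for x
        by (meson less_le_trans)+
      then have empty: "{x. 0 < u \<and> u < f x} = {}" "{x. 0 < u \<and> u < g x} = {}"
        by blast+
      show ?thesis unfolding empty by simp
    qed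
  qed
  also have "\<dots> = (\<integral>\<^sup>+x. h x \<partial>lborel)"
    by (simp add: nn_integral_layer_cake h)
  finally show ?thesis .
qed

text \<open>
  Dividing \<open>f\<close> and \<open>g\<close> by their maxima, attained at \<open>0\<close>, reduces to the normalized case; the geometric
  mean of the normalized functions dominates their minimum, and the weighted inequality between the
  arithmetic and the geometric mean turns the resulting sum of integrals into a product.
\<close>

lemma prekopa_leindler_symmetric_decreasing:
  fixes f g h :: "real \<Rightarrow> real"
  assumes l: "0 \<le> l" "l \<le> 1"
    and [measurable]: "f \<in> borel_measurable borel" "g \<in> borel_measurable borel"
      "h \<in> borel_measurable borel"
    and f: "\<And>x. 0 \<le> f x" "\<And>x y. \<bar>x\<bar> \<le> \<bar>y\<bar> \<Longrightarrow> f y \<le> f x" "bounded {x. f x \<noteq> 0}"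
    and g: "\<And>x. 0 \<le> g x" "\<And>x y. \<bar>x\<bar> \<le> \<bar>y\<bar> \<Longrightarrow> g y \<le> g x" "bounded {x. g x \<noteq> 0}"
    and h: "\<And>x. 0 \<le> h x" "\<And>x y. f x powr (1 - l) * g y powr l \<le> h ((1 - l) * x + l * y)"
    and F: "(\<integral>\<^sup>+x. f x \<partial>lborel) = ennreal F" "0 \<le> F"
    and G: "(\<integral>\<^sup>+x. g x \<partial>lborel) = ennreal G" "0 \<le> G"
    and H: "(\<integral>\<^sup>+x. h x \<partial>lborel) = ennreal H" "0 \<le> H"
  shows "F powr (1 - l) * G powr l \<le> H"
proof (cases "F = 0 \<or> G = 0")
  case True
  then show ?thesis using H by auto
next
  case False
  then have pos: "0 < F" "0 < G" using F G by auto
  have f0: "0 < f 0"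
  proof (rule ccontr)
    assume "\<not> 0 < f 0"
    then have "f x = 0" for x using f(1)[of x] f(2)[of 0 x] by auto
    then show False using F pos by simp
  qed
  have g0: "0 < g 0"
  proof (rule ccontr)
    assume "\<not> 0 < g 0"
    then have "g x = 0" for x using g(1)[of x] g(2)[of 0 x] by auto
    then show False using G pos by simp
  qed
  let ?c = "f 0 powr (1 - l) * g 0 powr l"
  have c: "0 < ?c" using f0 g0 by simp
  have min_le: "min a b \<le> a powr (1 - l) * b powr l" if "0 \<le> a" "0 \<le> b" for a b :: real
  proof (cases "min a b = 0")
    case False
    then have "0 < min a b" using that by (auto simp: min_def split: if_splits)
    then have "min a b = min a b powr (1 - l) * min a b powr l"
      by (simp add: powr_add[symmetric])
    also have "\<dots> \<le> a powr (1 - l) * b powr l"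
      using that l \<open>0 < min a b\<close> by (intro mult_mono powr_mono2) auto
    finally show ?thesis .
  qed (use that in auto)
  have scale: "(\<integral>\<^sup>+x. k x / d \<partial>lborel) = ennreal (J / d)"
    if "(\<integral>\<^sup>+x. k x \<partial>lborel) = ennreal J" "0 \<le> J" "0 < d" "\<And>x. 0 \<le> k x"
      and [measurable]: "k \<in> borel_measurable borel" for k :: "real \<Rightarrow> real" and J d
  proof -
    have "(\<integral>\<^sup>+x. k x / d \<partial>lborel) = (\<integral>\<^sup>+x. ennreal (k x) * ennreal (1 / d) \<partial>lborel)"
      using that by (intro nn_integral_cong) (simp flip: ennreal_mult)
    also have "\<dots> = ennreal J * ennreal (1 / d)"
      using that by (simp add: nn_integral_multc)
    finally show ?thesis using that by (simp flip: ennreal_mult)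
  qed
  have "ennreal (1 - l) * (\<integral>\<^sup>+x. f x / f 0 \<partial>lborel) + ennreal l * (\<integral>\<^sup>+x. g x / g 0 \<partial>lborel)
    \<le> (\<integral>\<^sup>+x. h x / ?c \<partial>lborel)"
  proof (rule prekopa_leindler_normalized[OF l])
    show "min (f x / f 0) (g y / g 0) \<le> h ((1 - l) * x + l * y) / ?c" for x y
    proof -
      have "min (f x / f 0) (g y / g 0) \<le> (f x / f 0) powr (1 - l) * (g y / g 0) powr l"
        by (rule min_le) (use f g in auto)
      also have "\<dots> = (f x powr (1 - l) * g y powr l) / ?c"
        using f g by (simp add: powr_divide)
      also have "\<dots> \<le> h ((1 - l) * x + l * y) / ?c"
        using c h by (intro divide_right_mono) auto
      finally show ?thesis .
    qed
    show "bounded {x. f x / f 0 \<noteq> 0}" "bounded {x. g x / g 0 \<noteq> 0}"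
      using f(3) g(3) f0 g0 by auto
  qed (use f g h f0 g0 c in \<open>auto intro: divide_right_mono\<close>)
  then have "ennreal ((1 - l) * (F / f 0) + l * (G / g 0)) \<le> ennreal (H / ?c)"
    using l pos f0 g0 F G H c
    by (simp add: scale[OF F] scale[OF G] scale[OF H] f g h ennreal_mult'[symmetric] ennreal_plus[symmetric]
        del: ennreal_plus times_divide_eq_right)
  then have le: "(1 - l) * (F / f 0) + l * (G / g 0) \<le> H / ?c"
    using H c by (subst (asm) ennreal_le_iff) auto
  have "(F / f 0) powr (1 - l) * (G / g 0) powr l \<le> (1 - l) * (F / f 0) + l * (G / g 0)"
    using l pos f0 g0 by (intro Youngs_inequality_0) auto
  with le have "(F / f 0) powr (1 - l) * (G / g 0) powr l \<le> H / ?c" by simp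
  then have "(F powr (1 - l) * G powr l) / ?c \<le> H / ?c"
    using pos f0 g0 by (simp add: powr_divide)
  then show ?thesis using c by (simp add: divide_le_cancel)
qed

section \<open>Log-concave functions\<close>

text \<open>
  The convention \<open>0 powr x = 0\<close>, also for \<open>x = 0\<close>, makes the inequality trivial for nonnegative \<open>V\<close> as
  soon as \<open>V\<close> vanishes at \<open>r\<close> or at \<open>s\<close>; this is the meaning of log-concavity for functions with zeros.
\<close>

definition log_concave :: "(real \<Rightarrow> real) \<Rightarrow> bool" where
  "log_concave V \<longleftrightarrow> (\<forall>r s l. 0 \<le> l \<longrightarrow> l \<le> 1 \<longrightarrow>
     V r powr (1 - l) * V s powr l \<le> V ((1 - l) * r + l * s))"

lemma log_concaveD:
  "log_concave V \<Longrightarrow> 0 \<le> l \<Longrightarrow> l \<le> 1 \<Longrightarrow> V r powr (1 - l) * V s powr l \<le> V ((1 - l) * r + l * s)"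
  by (simp add: log_concave_def)

text \<open>
  The inner points \<open>b\<close> and \<open>c\<close> are convex combinations of the outer points \<open>a\<close> and \<open>d\<close> with exchanged
  weights, so the product of the two instances of log-concavity has total exponent \<open>1\<close> on each of
  \<open>V a\<close> and \<open>V d\<close>.
\<close>

lemma log_concave_four_points:
  assumes "log_concave V" and nonneg: "\<And>r. 0 \<le> V r"
    and "a \<le> b" "b \<le> d" "a + d = b + c"
  shows "V a * V d \<le> V b * V c"
proof (cases "V a = 0 \<or> V d = 0 \<or> a = d")
  case True
  then show ?thesis using assms by auto
next
  case False
  define l where "l = (b - a) / (d - a)"
  have "a < d" using False assms by auto
  then have l: "0 \<le> l" "l \<le> 1" using assms by (auto simp: l_def field_simps)
  have "l * (d - a) = b - a" using \<open>a < d\<close> by (simp add: l_def)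
  then have b: "b = (1 - l) * a + l * d" and c: "c = (1 - (1 - l)) * a + (1 - l) * d"
    using assms by (auto simp: algebra_simps)
  have pos: "0 < V a" "0 < V d" using False nonneg[of a] nonneg[of d] by auto
  have "V a * V d = (V a powr (1 - l) * V d powr l) * (V a powr (1 - (1 - l)) * V d powr (1 - l))"
  proof -
    have "V a powr (1 - l) * V a powr l = V a" "V d powr l * V d powr (1 - l) = V d"
      using pos by (simp_all add: powr_add[symmetric])
    moreover have "(V a powr (1 - l) * V d powr l) * (V a powr (1 - (1 - l)) * V d powr (1 - l))
        = (V a powr (1 - l) * V a powr l) * (V d powr l * V d powr (1 - l))"
      by simp
    ultimately show ?thesis by (simp only:)
  qed
  also have "\<dots> \<le> V b * V c"
    unfolding b c using l by (intro mult_mono log_concaveD assms nonneg) auto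
  finally show ?thesis .
qed

lemma has_bochner_integral_laplace_even_moment:
  fixes b :: real
  assumes "0 < b"
  shows "has_bochner_integral lborel (\<lambda>x. x ^ (2 * k) * (b / 2 * exp (- b * \<bar>x\<bar>)))
    (fact (2 * k) / b ^ (2 * k))"
proof -
  have "has_bochner_integral lborel (\<lambda>x::real. indicator {0..} x *\<^sub>R (x ^ (2 * k) * exp (- \<bar>x\<bar>))) (fact (2 * k))"
  proof (rule has_bochner_integral_nn_integral)
    have "(\<integral>\<^sup>+x. ennreal (indicator {0..} x *\<^sub>R (x ^ (2 * k) * exp (- \<bar>x\<bar>))) \<partial>lborel)
        = (\<integral>\<^sup>+x. ennreal (x ^ (2 * k) * exp (- x)) * indicator {0..} x \<partial>lborel)"
      by (intro nn_integral_cong) (auto simp: indicator_def)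
    then show "(\<integral>\<^sup>+x. ennreal (indicator {0..} x *\<^sub>R (x ^ (2 * k) * exp (- \<bar>x\<bar>))) \<partial>lborel) = ennreal (fact (2 * k))"
      by (simp add: nn_intergal_power_times_exp_Ici)
  qed auto
  then have "has_bochner_integral lborel (\<lambda>x::real. x ^ (2 * k) * exp (- \<bar>x\<bar>)) (2 *\<^sub>R fact (2 * k))"
    by (rule has_bochner_integral_even_function) (simp add: power_mult)
  then have "has_bochner_integral lborel (\<lambda>x::real. (0 + b * x) ^ (2 * k) * exp (- \<bar>0 + b * x\<bar>)) ((2 *\<^sub>R fact (2 * k)) /\<^sub>R \<bar>b\<bar>)"
    using assms by (subst (asm) lborel_has_bochner_integral_real_affine_iff[of b _ _ 0]) auto
  then have "has_bochner_integral lborel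
      (\<lambda>x::real. (b / 2 / b ^ (2 * k)) * ((0 + b * x) ^ (2 * k) * exp (- \<bar>0 + b * x\<bar>)))
      ((b / 2 / b ^ (2 * k)) * ((2 *\<^sub>R fact (2 * k)) /\<^sub>R \<bar>b\<bar>))"
    by (rule has_bochner_integral_mult_right)
  moreover have "(b / 2 / b ^ (2 * k)) * ((0 + b * x) ^ (2 * k) * exp (- \<bar>0 + b * x\<bar>))
      = x ^ (2 * k) * (b / 2 * exp (- b * \<bar>x\<bar>))" for x
    using assms by (simp add: power_mult_distrib abs_mult)
  moreover have "(b / 2 / b ^ (2 * k)) * ((2 *\<^sub>R fact (2 * k)) /\<^sub>R \<bar>b\<bar>) = fact (2 * k) / b ^ (2 * k)"
    using assms by (simp add: field_simps)
  ultimately show ?thesis by (simp only:)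
qed

text \<open>
  Let \<open>g\<close> be the Laplace density with the same variance \<open>v\<close>. On the half-line \<open>ln g\<close> is affine, so
  \<open>{x \<ge> 0. g x \<le> \<phi> x}\<close> is an interval, with end points \<open>p \<le> q\<close> say. Hence \<open>\<phi> - g\<close> is nonpositive for
  \<open>\<bar>x\<bar> < p\<close>, nonnegative between \<open>p\<close> and \<open>q\<close> and nonpositive beyond, always opposite to the sign of
  \<open>(x\<^sup>2 - p\<^sup>2) (x\<^sup>2 - q\<^sup>2)\<close>. Integrating the product of the two, the constant and the quadratic term of
  the polynomial disappear since the moments of order \<open>0\<close> and \<open>2\<close> agree; what remains is
  \<open>m \<le> 6 v\<^sup>2\<close>, the right-hand side being the fourth moment of \<open>g\<close>.
\<close>

lemma log_concave_fourth_moment: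
  fixes \<phi> :: "real \<Rightarrow> real"
  assumes even: "\<And>x. \<phi> \<bar>x\<bar> = \<phi> x"
    and lc: "\<And>x y l. 0 \<le> x \<Longrightarrow> 0 \<le> y \<Longrightarrow> 0 \<le> l \<Longrightarrow> l \<le> 1 \<Longrightarrow>
      \<phi> x powr (1 - l) * \<phi> y powr l \<le> \<phi> ((1 - l) * x + l * y)"
    and supp: "\<And>x. R < \<bar>x\<bar> \<Longrightarrow> \<phi> x = 0"
    and M0: "has_bochner_integral lborel \<phi> 1"
    and M2: "has_bochner_integral lborel (\<lambda>x. x\<^sup>2 * \<phi> x) v"
    and M4: "has_bochner_integral lborel (\<lambda>x. x ^ 4 * \<phi> x) m"
    and "0 < v"
  shows "m \<le> 6 * v\<^sup>2"
proof -
  \<comment> \<open>The Laplace density \<open>b / 2 * exp (- b * \<bar>x\<bar>)\<close> has variance \<open>2 / b\<^sup>2\<close>.\<close>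
  define b where "b = sqrt (2 / v)"
  have b: "0 < b" "b\<^sup>2 = 2 / v" using \<open>0 < v\<close> by (auto simp: b_def)
  define g where "g x = b / 2 * exp (- b * \<bar>x\<bar>)" for x
  have gpos: "0 < g x" for x using b by (simp add: g_def)
  have g0: "has_bochner_integral lborel g 1"
    using has_bochner_integral_laplace_even_moment[OF b(1), of 0] by (simp add: g_def[abs_def])
  have g2: "has_bochner_integral lborel (\<lambda>x. x\<^sup>2 * g x) v"
    using has_bochner_integral_laplace_even_moment[OF b(1), of 1] b by (simp add: g_def[abs_def])
  have "b ^ 4 = 4 / v\<^sup>2"
  proof -
    have "b ^ 4 = (b\<^sup>2)\<^sup>2" by (simp flip: power_mult)
    then show ?thesis by (simp add: b power_divide)
  qed
  then have g4: "has_bochner_integral lborel (\<lambda>x. x ^ 4 * g x) (6 * v\<^sup>2)"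
    using has_bochner_integral_laplace_even_moment[OF b(1), of 2] by (simp add: g_def[abs_def] fact_numeral)
  have g_log_linear: "g ((1 - l) * x + l * y) = g x powr (1 - l) * g y powr l"
    if "0 \<le> x" "0 \<le> y" "0 \<le> l" "l \<le> 1" for x y l
  proof -
    have "0 \<le> (1 - l) * x + l * y" using that by simp
    moreover have "ln (b / 2 * exp (- b * z)) = ln (b / 2) - b * z" for z
      using b by (subst ln_mult) auto
    moreover have "exp (ln (b / 2)) = b / 2" using b by simp
    ultimately have "g ((1 - l) * x + l * y) = exp (ln (b / 2)) * exp (- b * ((1 - l) * x + l * y))"
      "g x powr (1 - l) * g y powr l
        = exp ((1 - l) * (ln (b / 2) - b * x)) * exp (l * (ln (b / 2) - b * y))"
      using that b by (simp_all add: g_def powr_def)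
    then show ?thesis by (simp add: exp_add[symmetric] algebra_simps)
  qed
  obtain p q where pq: "0 \<le> p" "p \<le> q"
    and inside: "\<And>x. p < x \<Longrightarrow> x < q \<Longrightarrow> g x \<le> \<phi> x"
    and outside: "\<And>x. 0 \<le> x \<Longrightarrow> x < p \<or> q < x \<Longrightarrow> \<phi> x \<le> g x"
  proof -
    define S where "S = {x. 0 \<le> x \<and> g x \<le> \<phi> x}"
    show ?thesis
    proof (cases "S = {}")
      \<comment> \<open>A degenerate interval imposes nothing between its end points.\<close>
      case True
      then show ?thesis
        by (intro that[of 0 0]) (auto simp: S_def intro: less_imp_le[OF not_le_imp_less])
    next
      case False
      have bdd: "bdd_above S" "bdd_below S"
      proof -
        have "x \<le> R" if "x \<in> S" for x
          using that gpos[of x] supp[of x] by (force simp: S_def)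
        then show "bdd_above S" by (auto simp: bdd_above_def)
        show "bdd_below S" by (auto simp: S_def bdd_below_def)
      qed
      show ?thesis
      proof (rule that[of "Inf S" "Sup S"])
        show "0 \<le> Inf S" using False by (intro cInf_greatest) (auto simp: S_def)
        show "Inf S \<le> Sup S" using False bdd by (intro cInf_le_cSup)
        show "g x \<le> \<phi> x" if lo: "Inf S < x" and hi: "x < Sup S" for x
        proof -
          obtain x1 where x1: "x1 \<in> S" "x1 < x"
            using lo unfolding cInf_less_iff[OF False bdd(2)] by blast
          obtain x2 where x2: "x2 \<in> S" "x < x2"
            using hi unfolding less_cSup_iff[OF False bdd(1)] by blast
          define l where "l = (x - x1) / (x2 - x1)"
          have l: "0 \<le> l" "l \<le> 1" using x1 x2 by (auto simp: l_def field_simps)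
          have "l * (x2 - x1) = x - x1" using x1 x2 by (simp add: l_def)
          then have x: "x = (1 - l) * x1 + l * x2" by (simp add: algebra_simps)
          have "g x = g x1 powr (1 - l) * g x2 powr l"
            unfolding x using x1 x2 l by (intro g_log_linear) (auto simp: S_def)
          also have "\<dots> \<le> \<phi> x1 powr (1 - l) * \<phi> x2 powr l"
            using x1 x2 l gpos[of x1] gpos[of x2] by (intro mult_mono powr_mono2) (auto simp: S_def)
          also have "\<dots> \<le> \<phi> x"
            unfolding x using x1 x2 l by (intro lc) (auto simp: S_def)
          finally show ?thesis .
        qed
        show "\<phi> x \<le> g x" if "0 \<le> x" "x < Inf S \<or> Sup S < x" for x
        proof -
          have "x \<notin> S"
            using that(2) cInf_lower[OF _ bdd(2), of x] cSup_upper[OF _ bdd(1), of x] by auto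
          then show ?thesis using that(1) by (simp add: S_def)
        qed
      qed
    qed
  qed
  have sign: "(x\<^sup>2 - p\<^sup>2) * (x\<^sup>2 - q\<^sup>2) * (\<phi> x - g x) \<le> 0" for x
  proof -
    have sq: "x\<^sup>2 < y\<^sup>2 \<longleftrightarrow> \<bar>x\<bar> < y" "y\<^sup>2 < x\<^sup>2 \<longleftrightarrow> y < \<bar>x\<bar>" if "0 \<le> y" for y
      using that power2_less_imp_less[of "\<bar>x\<bar>" y] power2_less_imp_less[of y "\<bar>x\<bar>"]
        power_strict_mono[of "\<bar>x\<bar>" y 2] power_strict_mono[of y "\<bar>x\<bar>" 2] by auto
    have [simp]: "g \<bar>x\<bar> = g x" by (simp add: g_def)
    consider "p < \<bar>x\<bar>" "\<bar>x\<bar> < q" | "\<bar>x\<bar> < p" | "q < \<bar>x\<bar>" | "\<bar>x\<bar> = p \<or> \<bar>x\<bar> = q" by linarith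
    then show ?thesis
    proof cases
      case 1
      then have "g x \<le> \<phi> x" using inside[of "\<bar>x\<bar>"] by (simp add: even)
      moreover have "0 \<le> x\<^sup>2 - p\<^sup>2" "x\<^sup>2 - q\<^sup>2 \<le> 0" using 1 pq sq(2)[of p] sq(1)[of q] by auto
      ultimately show ?thesis
        by (intro mult_nonpos_nonneg mult_nonneg_nonpos) auto
    next
      case 2
      then have "\<phi> x \<le> g x" using outside[of "\<bar>x\<bar>"] by (simp add: even)
      moreover have "x\<^sup>2 - p\<^sup>2 \<le> 0" "x\<^sup>2 - q\<^sup>2 \<le> 0" using 2 pq sq(1)[of p] sq(1)[of q] by auto
      ultimately show ?thesis
        by (intro mult_nonneg_nonpos mult_nonpos_nonpos) auto
    next
      case 3
      then have "\<phi> x \<le> g x" using outside[of "\<bar>x\<bar>"] by (simp add: even)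
      moreover have "0 \<le> x\<^sup>2 - p\<^sup>2" "0 \<le> x\<^sup>2 - q\<^sup>2" using 3 pq sq(2)[of p] sq(2)[of q] by auto
      ultimately show ?thesis
        by (intro mult_nonneg_nonpos mult_nonneg_nonneg) auto
    next
      case 4
      then have "x\<^sup>2 = p\<^sup>2 \<or> x\<^sup>2 = q\<^sup>2" by (metis power2_abs)
      then show ?thesis by auto
    qed
  qed
  have "has_bochner_integral lborel
      (\<lambda>x. (x ^ 4 * \<phi> x - x ^ 4 * g x) - (p\<^sup>2 + q\<^sup>2) * (x\<^sup>2 * \<phi> x - x\<^sup>2 * g x) + p\<^sup>2 * q\<^sup>2 * (\<phi> x - g x))
      ((m - 6 * v\<^sup>2) - (p\<^sup>2 + q\<^sup>2) * (v - v) + p\<^sup>2 * q\<^sup>2 * (1 - 1))"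
    by (intro has_bochner_integral_add has_bochner_integral_diff has_bochner_integral_mult_right
        M0 M2 M4 g0 g2 g4)
  moreover have "(x ^ 4 * \<phi> x - x ^ 4 * g x) - (p\<^sup>2 + q\<^sup>2) * (x\<^sup>2 * \<phi> x - x\<^sup>2 * g x) + p\<^sup>2 * q\<^sup>2 * (\<phi> x - g x)
      = (x\<^sup>2 - p\<^sup>2) * (x\<^sup>2 - q\<^sup>2) * (\<phi> x - g x)" for x
    by algebra
  ultimately have int: "has_bochner_integral lborel (\<lambda>x. (x\<^sup>2 - p\<^sup>2) * (x\<^sup>2 - q\<^sup>2) * (\<phi> x - g x)) (m - 6 * v\<^sup>2)"
    by simp
  have "m - 6 * v\<^sup>2 = (\<integral>x. (x\<^sup>2 - p\<^sup>2) * (x\<^sup>2 - q\<^sup>2) * (\<phi> x - g x) \<partial>lborel)"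
    using has_bochner_integral_integral_eq[OF int] by simp
  also have "\<dots> \<le> (\<integral>x. 0 \<partial>(lborel :: real measure))"
    using int by (intro integral_mono sign) (auto simp: has_bochner_integral_iff)
  finally show ?thesis by simp
qed

section \<open>Chebyshev's association inequality\<close>

text \<open>
  The hypothesis says that \<open>p / q\<close> decreases as \<open>s\<close> increases. Integrating
  \<open>(s y - s z) (p y q z - p z q y) \<le> 0\<close> over both variables gives twice the claim. Moving the negative
  products to the other side keeps everything in the extended nonnegative reals, where no
  integrability has to be discussed.
\<close>

lemma chebyshev_association:
  fixes p q s :: "'a \<Rightarrow> ennreal"
  assumes [measurable]: "p \<in> borel_measurable N" "q \<in> borel_measurable N" "s \<in> borel_measurable N"
    and ratio: "\<And>y z. s z \<le> s y \<Longrightarrow> p y * q z \<le> p z * q y"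
  shows "(\<integral>\<^sup>+y. s y * p y \<partial>N) * (\<integral>\<^sup>+y. q y \<partial>N) \<le> (\<integral>\<^sup>+y. p y \<partial>N) * (\<integral>\<^sup>+y. s y * q y \<partial>N)"
    (is "?SP * ?Q \<le> ?P * ?SQ")
proof -
  have ordered: "s y * p y * q z + s z * p z * q y \<le> s y * q y * p z + s z * q z * p y"
    if "s z \<le> s y" for y z
  proof -
    obtain d where d: "s y = s z + d" using \<open>s z \<le> s y\<close> le_iff_add by metis
    have "s y * p y * q z + s z * p z * q y = s z * (p y * q z + p z * q y) + d * (p y * q z)"
      unfolding d by (simp add: algebra_simps)
    also have "\<dots> \<le> s z * (p y * q z + p z * q y) + d * (p z * q y)"
      using ratio[OF that] by (intro add_left_mono mult_left_mono) auto
    also have "\<dots> = s y * q y * p z + s z * q z * p y"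
      unfolding d by (simp add: algebra_simps)
    finally show ?thesis .
  qed
  have pointwise: "s y * p y * q z + s z * p z * q y \<le> s y * q y * p z + s z * q z * p y" for y z
    using ordered[of z y] ordered[of y z] by (cases "s z \<le> s y") (auto simp: add.commute)
  have "2 * (?SP * ?Q) = (\<integral>\<^sup>+z. \<integral>\<^sup>+y. s y * p y * q z + s z * p z * q y \<partial>N \<partial>N)"
    by (simp add: nn_integral_add nn_integral_cmult nn_integral_multc mult_2 mult.commute)
  also have "\<dots> \<le> (\<integral>\<^sup>+z. \<integral>\<^sup>+y. s y * q y * p z + s z * q z * p y \<partial>N \<partial>N)"
    by (intro nn_integral_mono pointwise)
  also have "\<dots> = 2 * (?P * ?SQ)"
    by (simp add: nn_integral_add nn_integral_cmult nn_integral_multc mult_2 mult.commute)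
  finally show ?thesis
    by (subst (asm) ennreal_mult_le_mult_iff) auto
qed

section \<open>Young functions of the absolute value\<close>

lemma young_abs_mono:
  assumes "young_function f" "\<bar>x\<bar> \<le> \<bar>y\<bar>"
  shows "f \<bar>x\<bar> \<le> f \<bar>y\<bar>"
proof -
  have "strict_mono_on {0..} f" using assms by (simp add: young_function_def)
  then show ?thesis
    using assms(2) strict_mono_onD[of "{0..}" f "\<bar>x\<bar>" "\<bar>y\<bar>"] by (cases "\<bar>x\<bar> = \<bar>y\<bar>") auto
qed

lemma young_abs_nonneg: "young_function f \<Longrightarrow> 0 \<le> f \<bar>x\<bar>"
  by (auto simp: young_function_def)

lemma young_abs_convex:
  assumes "young_function f" "0 \<le> l" "l \<le> 1"
  shows "f \<bar>(1 - l) * x + l * y\<bar> \<le> (1 - l) * f \<bar>x\<bar> + l * f \<bar>y\<bar>"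
proof -
  have "\<bar>(1 - l) * x + l * y\<bar> \<le> (1 - l) * \<bar>x\<bar> + l * \<bar>y\<bar>"
    using abs_triangle_ineq[of "(1 - l) * x" "l * y"] assms by (simp add: abs_mult)
  moreover have "0 \<le> (1 - l) * \<bar>x\<bar> + l * \<bar>y\<bar>" using assms by simp
  ultimately have "f \<bar>(1 - l) * x + l * y\<bar> \<le> f ((1 - l) * \<bar>x\<bar> + l * \<bar>y\<bar>)"
    using young_abs_mono[OF assms(1), of "(1 - l) * x + l * y" "(1 - l) * \<bar>x\<bar> + l * \<bar>y\<bar>"] by simp
  also have "\<dots> \<le> (1 - l) * f \<bar>x\<bar> + l * f \<bar>y\<bar>"
    using assms convex_onD[of "{0..}" f l "\<bar>x\<bar>" "\<bar>y\<bar>"] by (simp add: young_function_def)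
  finally show ?thesis .
qed

lemma young_abs_measurable:
  assumes "young_function f"
  shows "(\<lambda>x. f \<bar>x\<bar>) \<in> borel_measurable borel"
proof -
  have "mono (\<lambda>x. f (max 0 x))"
    by (intro monoI) (use young_abs_mono[OF assms, of "max 0 _" "max 0 _"] in auto)
  then have [measurable]: "(\<lambda>x. f (max 0 x)) \<in> borel_measurable borel"
    by (rule borel_measurable_mono)
  have "(\<lambda>x. f (max 0 \<bar>x\<bar>)) \<in> borel_measurable borel"
    by measurable
  then show ?thesis by simp
qed

text \<open>
  Sublevel sets are bounded because convexity and \<open>f 0 = 0\<close> give \<open>\<bar>x\<bar> f 1 \<le> f \<bar>x\<bar>\<close> for \<open>\<bar>x\<bar> \<ge> 1\<close>.
\<close>

lemma young_abs_coercive: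
  assumes "young_function f"
  obtains R where "\<And>x. f \<bar>x\<bar> \<le> r \<Longrightarrow> \<bar>x\<bar> \<le> R"
proof
  fix x assume x: "f \<bar>x\<bar> \<le> r"
  have f1: "0 < f 1"
    using assms strict_mono_onD[of "{0..}" f 0 1] by (simp add: young_function_def)
  show "\<bar>x\<bar> \<le> max 1 (r / f 1)"
  proof (cases "\<bar>x\<bar> \<le> 1")
    case False
    have "f 1 \<le> (1 / \<bar>x\<bar>) * f \<bar>x\<bar>"
      using young_abs_convex[OF assms, of "1 / \<bar>x\<bar>" 0 "\<bar>x\<bar>"] False assms
      by (auto simp: young_function_def split: if_splits)
    then have "\<bar>x\<bar> * f 1 \<le> f \<bar>x\<bar>" using False by (simp add: field_simps)
    with x f1 have "\<bar>x\<bar> \<le> r / f 1" by (simp add: field_simps)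
    then show ?thesis by simp
  qed simp
qed

section \<open>Volumes of Orlicz bodies\<close>

definition orlicz_volume :: "('i \<Rightarrow> real \<Rightarrow> real) \<Rightarrow> 'i set \<Rightarrow> real \<Rightarrow> ennreal" where
  "orlicz_volume f I r =
     (\<integral>\<^sup>+x. indicator {..r} (\<Sum>i\<in>I. f i \<bar>x i\<bar>) \<partial>Pi\<^sub>M I (\<lambda>_. lborel))"

context
  fixes f :: "'i \<Rightarrow> real \<Rightarrow> real"
  assumes young: "\<And>i. young_function (f i)"
begin

lemma young_measurable [measurable]: "(\<lambda>x. f i \<bar>x\<bar>) \<in> borel_measurable borel"
  using young by (rule young_abs_measurable)

lemma orlicz_volume_mono: "mono (orlicz_volume f I)"
  unfolding orlicz_volume_def
  by (intro monoI nn_integral_mono) (auto simp: indicator_def)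

lemma orlicz_volume_eq_0: "r < 0 \<Longrightarrow> orlicz_volume f I r = 0"
proof -
  assume "r < 0"
  moreover have "0 \<le> (\<Sum>i\<in>I. f i \<bar>x i\<bar>)" for x
    by (intro sum_nonneg young_abs_nonneg young)
  ultimately have "\<not> (\<Sum>i\<in>I. f i \<bar>x i\<bar>) \<le> r" for x
    by (meson less_le_trans not_le)
  then show ?thesis by (simp add: orlicz_volume_def)
qed

text \<open>
  Fubini's theorem: fixing the coordinate \<open>x i = a\<close> leaves the body of the other coordinates
  at the level \<open>r - f i \<bar>a\<bar>\<close>.
\<close>

lemma nn_integral_orlicz_insert:
  fixes h :: "real \<Rightarrow> ennreal"
  assumes I: "finite I" "i \<notin> I" and [measurable]: "h \<in> borel_measurable borel"
  shows "(\<integral>\<^sup>+x. h (x i) * indicator {..r} (\<Sum>k\<in>insert i I. f k \<bar>x k\<bar>) \<partial>Pi\<^sub>M (insert i I) (\<lambda>_. lborel))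
    = (\<integral>\<^sup>+a. h a * orlicz_volume f I (r - f i \<bar>a\<bar>) \<partial>lborel)"
proof -
  interpret product_sigma_finite "\<lambda>_::'i. lborel :: real measure" ..
  have "(\<integral>\<^sup>+x. h (x i) * indicator {..r} (\<Sum>k\<in>insert i I. f k \<bar>x k\<bar>) \<partial>Pi\<^sub>M (insert i I) (\<lambda>_. lborel))
    = (\<integral>\<^sup>+a. \<integral>\<^sup>+x. h ((x(i := a)) i) * indicator {..r} (\<Sum>k\<in>insert i I. f k \<bar>(x(i := a)) k\<bar>)
         \<partial>Pi\<^sub>M I (\<lambda>_. lborel) \<partial>lborel)"
    by (rule product_nn_integral_insert_rev[OF I]) measurable
  also have "\<dots> = (\<integral>\<^sup>+a. \<integral>\<^sup>+x. h a * indicator {..r - f i \<bar>a\<bar>} (\<Sum>k\<in>I. f k \<bar>x k\<bar>)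
         \<partial>Pi\<^sub>M I (\<lambda>_. lborel) \<partial>lborel)"
  proof (intro nn_integral_cong)
    fix a :: real and x :: "'i \<Rightarrow> real"
    have "(\<Sum>k\<in>I. f k \<bar>(x(i := a)) k\<bar>) = (\<Sum>k\<in>I. f k \<bar>x k\<bar>)"
      using I by (intro sum.cong) auto
    then show "h ((x(i := a)) i) * indicator {..r} (\<Sum>k\<in>insert i I. f k \<bar>(x(i := a)) k\<bar>)
      = h a * indicator {..r - f i \<bar>a\<bar>} (\<Sum>k\<in>I. f k \<bar>x k\<bar>)"
      using I by (auto simp: indicator_def)
  qed
  also have "\<dots> = (\<integral>\<^sup>+a. h a * orlicz_volume f I (r - f i \<bar>a\<bar>) \<partial>lborel)"
    unfolding orlicz_volume_def by (intro nn_integral_cong nn_integral_cmult) measurable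
  finally show ?thesis .
qed

lemma orlicz_volume_insert:
  assumes "finite I" "i \<notin> I"
  shows "orlicz_volume f (insert i I) r = (\<integral>\<^sup>+a. orlicz_volume f I (r - f i \<bar>a\<bar>) \<partial>lborel)"
  using nn_integral_orlicz_insert[OF assms, of "\<lambda>_. 1"] by (simp add: orlicz_volume_def)

lemma orlicz_volume_finite: "finite I \<Longrightarrow> orlicz_volume f I r < \<infinity>"
proof (induction I arbitrary: r rule: finite_induct)
  case empty
  then show ?case
    by (simp add: orlicz_volume_def PiM_empty nn_integral_count_space_finite indicator_def)
next
  case (insert i I)
  obtain R where R: "\<And>x. f i \<bar>x\<bar> \<le> r \<Longrightarrow> \<bar>x\<bar> \<le> R"
    using young_abs_coercive[OF young] by blast
  have "orlicz_volume f (insert i I) r = (\<integral>\<^sup>+a. orlicz_volume f I (r - f i \<bar>a\<bar>) \<partial>lborel)"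
    using insert by (simp add: orlicz_volume_insert)
  also have "\<dots> \<le> (\<integral>\<^sup>+a. orlicz_volume f I r * indicator {-R..R} a \<partial>lborel)"
  proof (rule nn_integral_mono)
    fix a
    show "orlicz_volume f I (r - f i \<bar>a\<bar>) \<le> orlicz_volume f I r * indicator {-R..R} a"
    proof (cases "f i \<bar>a\<bar> \<le> r")
      case True
      then have "a \<in> {-R..R}" using R by fastforce
      then show ?thesis
        using young_abs_nonneg[OF young, of i a] by (simp add: monoD[OF orlicz_volume_mono])
    qed (simp add: orlicz_volume_eq_0)
  qed
  also have "\<dots> < \<infinity>"
    using insert.IH[of r] by (auto simp: nn_integral_cmult ennreal_mult_less_top emeasure_lborel_Icc_eq)
  finally show ?case .
qed

lemma ennreal_orlicz_volume:
  "finite I \<Longrightarrow> ennreal (enn2real (orlicz_volume f I r)) = orlicz_volume f I r"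
  using orlicz_volume_finite[of I r] by simp

lemma orlicz_volume_real_mono:
  "finite I \<Longrightarrow> mono (\<lambda>r. enn2real (orlicz_volume f I r))"
  using orlicz_volume_finite[of I]
  by (intro monoI enn2real_mono) (auto intro: monoD[OF orlicz_volume_mono])

lemma orlicz_volume_real_measurable:
  "finite I \<Longrightarrow> (\<lambda>r. enn2real (orlicz_volume f I r)) \<in> borel_measurable borel"
  by (intro borel_measurable_mono orlicz_volume_real_mono)

lemma orlicz_volume_measurable:
  assumes "finite I" shows "orlicz_volume f I \<in> borel_measurable borel"
proof -
  have "(\<lambda>r. ennreal (enn2real (orlicz_volume f I r))) \<in> borel_measurable borel"
    using orlicz_volume_real_measurable[OF assms] by measurable
  then show ?thesis using assms by (simp add: ennreal_orlicz_volume)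
qed

text \<open>
  In the induction step, \<open>V (r - f i \<bar>x\<bar>)\<close> is log-concave in \<open>(r, x)\<close> jointly, because
  \<open>r - f i \<bar>x\<bar>\<close> is concave and \<open>V\<close> is increasing and log-concave. Integrating out \<open>x\<close> preserves
  log-concavity by Prekopa--Leindler, applied to the slices at the levels \<open>r\<close>, \<open>s\<close> and
  \<open>(1 - l) r + l s\<close>. The induction starts with the indicator function of the half-line.
\<close>

lemma orlicz_volume_log_concave:
  "finite I \<Longrightarrow> log_concave (\<lambda>r. enn2real (orlicz_volume f I r))"
proof (induction I rule: finite_induct)
  case empty
  have [simp]: "enn2real (orlicz_volume f {} r) = indicator {0..} r" for r
    by (simp add: orlicz_volume_def PiM_empty nn_integral_count_space_finite indicator_def)
  show ?case
    by (auto simp: log_concave_def indicator_def add_nonneg_nonneg)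
next
  case (insert i I)
  let ?V = "\<lambda>r. enn2real (orlicz_volume f I r)"
  note [measurable] = orlicz_volume_real_measurable[OF \<open>finite I\<close>]
  note V_mono = monoD[OF orlicz_volume_real_mono[OF \<open>finite I\<close>]]
  have slice: "(\<integral>\<^sup>+x. ennreal (?V (r - f i \<bar>x\<bar>)) \<partial>lborel)
      = ennreal (enn2real (orlicz_volume f (insert i I) r))" for r
    using insert.hyps
    by (simp only: ennreal_orlicz_volume finite_insert) (rule orlicz_volume_insert[symmetric])
  have decr: "?V (r - f i \<bar>y\<bar>) \<le> ?V (r - f i \<bar>x\<bar>)" if "\<bar>x\<bar> \<le> \<bar>y\<bar>" for r x y
    using young_abs_mono[OF young that, of i] by (intro V_mono) auto
  have bdd: "bounded {x. ?V (r - f i \<bar>x\<bar>) \<noteq> 0}" for r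
  proof -
    obtain R where R: "\<And>x. f i \<bar>x\<bar> \<le> r \<Longrightarrow> \<bar>x\<bar> \<le> R"
      using young_abs_coercive[OF young] by blast
    have "\<bar>x\<bar> \<le> R" if "?V (r - f i \<bar>x\<bar>) \<noteq> 0" for x
      using that orlicz_volume_eq_0[of "r - f i \<bar>x\<bar>" I] by (intro R) force
    then show ?thesis by (auto simp: bounded_iff)
  qed
  show ?case
    unfolding log_concave_def
  proof (intro allI impI)
    fix r s l :: real assume l: "0 \<le> l" "l \<le> 1"
    show "enn2real (orlicz_volume f (insert i I) r) powr (1 - l) *
        enn2real (orlicz_volume f (insert i I) s) powr l
        \<le> enn2real (orlicz_volume f (insert i I) ((1 - l) * r + l * s))"
    proof (rule prekopa_leindler_symmetric_decreasing[OF l _ _ _ _ _ _ _ _ _ _ _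
          slice _ slice _ slice])
      fix x y
      have "?V (r - f i \<bar>x\<bar>) powr (1 - l) * ?V (s - f i \<bar>y\<bar>) powr l
          \<le> ?V ((1 - l) * (r - f i \<bar>x\<bar>) + l * (s - f i \<bar>y\<bar>))"
        using insert.IH l by (rule log_concaveD)
      also have "\<dots> \<le> ?V ((1 - l) * r + l * s - f i \<bar>(1 - l) * x + l * y\<bar>)"
        using young_abs_convex[OF young l, of i x y] by (intro V_mono) (simp add: algebra_simps)
      finally show "?V (r - f i \<bar>x\<bar>) powr (1 - l) * ?V (s - f i \<bar>y\<bar>) powr l
          \<le> ?V ((1 - l) * r + l * s - f i \<bar>(1 - l) * x + l * y\<bar>)" .
    qed (use decr bdd in auto)
  qed
qed

lemma orlicz_volume_four_points:
  assumes "finite I" "a \<le> b" "b \<le> d" "a + d = b + c"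
  shows "orlicz_volume f I a * orlicz_volume f I d \<le> orlicz_volume f I b * orlicz_volume f I c"
proof -
  have "ennreal (enn2real (orlicz_volume f I a) * enn2real (orlicz_volume f I d))
    \<le> ennreal (enn2real (orlicz_volume f I b) * enn2real (orlicz_volume f I c))"
    by (intro ennreal_leI log_concave_four_points[OF orlicz_volume_log_concave] assms) auto
  then show ?thesis
    using assms(1) by (simp add: ennreal_mult' ennreal_orlicz_volume)
qed

section \<open>Second and fourth moments of the coordinates\<close>

lemma nn_integral_orlicz_insert2:
  fixes h :: "real \<Rightarrow> real \<Rightarrow> ennreal"
  assumes I: "finite I" "i \<notin> I" "j \<notin> I" "i \<noteq> j"
    and [measurable]: "case_prod h \<in> borel_measurable (borel \<Otimes>\<^sub>M borel)"
  shows "(\<integral>\<^sup>+x. h (x i) (x j) * indicator {..r} (\<Sum>k\<in>insert i (insert j I). f k \<bar>x k\<bar>)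
      \<partial>Pi\<^sub>M (insert i (insert j I)) (\<lambda>_. lborel))
    = (\<integral>\<^sup>+a. \<integral>\<^sup>+b. h a b * orlicz_volume f I (r - f i \<bar>a\<bar> - f j \<bar>b\<bar>) \<partial>lborel \<partial>lborel)"
proof -
  interpret product_sigma_finite "\<lambda>_::'i. lborel :: real measure" ..
  have "(\<integral>\<^sup>+x. h (x i) (x j) * indicator {..r} (\<Sum>k\<in>insert i (insert j I). f k \<bar>x k\<bar>)
      \<partial>Pi\<^sub>M (insert i (insert j I)) (\<lambda>_. lborel))
    = (\<integral>\<^sup>+a. \<integral>\<^sup>+x. h ((x(i := a)) i) ((x(i := a)) j)
         * indicator {..r} (\<Sum>k\<in>insert i (insert j I). f k \<bar>(x(i := a)) k\<bar>)
         \<partial>Pi\<^sub>M (insert j I) (\<lambda>_. lborel) \<partial>lborel)"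
    by (rule product_nn_integral_insert_rev) (use I in \<open>auto simp del: sum.insert\<close>)
  also have "\<dots> = (\<integral>\<^sup>+a. \<integral>\<^sup>+x. h a (x j) * indicator {..r - f i \<bar>a\<bar>} (\<Sum>k\<in>insert j I. f k \<bar>x k\<bar>)
         \<partial>Pi\<^sub>M (insert j I) (\<lambda>_. lborel) \<partial>lborel)"
  proof (intro nn_integral_cong)
    fix a :: real and x :: "'i \<Rightarrow> real"
    have "(\<Sum>k\<in>insert j I. f k \<bar>(x(i := a)) k\<bar>) = (\<Sum>k\<in>insert j I. f k \<bar>x k\<bar>)"
      using I by (intro sum.cong) auto
    moreover have "(\<Sum>k\<in>insert i (insert j I). f k \<bar>(x(i := a)) k\<bar>)
        = f i \<bar>a\<bar> + (\<Sum>k\<in>insert j I. f k \<bar>(x(i := a)) k\<bar>)"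
      by (subst sum.insert) (use I in auto)
    ultimately show "h ((x(i := a)) i) ((x(i := a)) j)
         * indicator {..r} (\<Sum>k\<in>insert i (insert j I). f k \<bar>(x(i := a)) k\<bar>)
      = h a (x j) * indicator {..r - f i \<bar>a\<bar>} (\<Sum>k\<in>insert j I. f k \<bar>x k\<bar>)"
      using I by (auto simp: indicator_def)
  qed
  also have "\<dots> = (\<integral>\<^sup>+a. \<integral>\<^sup>+b. h a b * orlicz_volume f I (r - f i \<bar>a\<bar> - f j \<bar>b\<bar>) \<partial>lborel \<partial>lborel)"
    by (intro nn_integral_cong nn_integral_orlicz_insert) (use I in auto)
  finally show ?thesis .
qed

text \<open>
  With \<open>\<phi>\<close> the joint density of the two coordinates, \<open>m0 a\<close> and \<open>m2 a\<close> are, up to normalization, the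
  marginal density of the first one and its product with the conditional second moment of the other.
  Association in \<open>b\<close> shows that this conditional moment \<open>m2 a / m0 a\<close> decreases as \<open>\<bar>a\<bar>\<close> grows;
  association in \<open>a\<close> then gives the negative correlation.
\<close>

lemma orlicz_square_negative_correlation:
  fixes r :: real
  assumes I: "finite I" "i \<in> I" "j \<in> I" "i \<noteq> j"
  defines "moment \<equiv> \<lambda>h. \<integral>\<^sup>+x. h x * indicator {..r} (\<Sum>k\<in>I. f k \<bar>x k\<bar>) \<partial>Pi\<^sub>M I (\<lambda>_. lborel)"
  shows "moment (\<lambda>x. ennreal ((x i)\<^sup>2) * ennreal ((x j)\<^sup>2)) * moment (\<lambda>_. 1)
    \<le> moment (\<lambda>x. ennreal ((x i)\<^sup>2)) * moment (\<lambda>x. ennreal ((x j)\<^sup>2))"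
proof -
  define J where "J = I - {i, j}"
  have J: "finite J" "i \<notin> J" "j \<notin> J" "i \<noteq> j" and I_eq: "I = insert i (insert j J)"
    using I by (auto simp: J_def)
  let ?W = "orlicz_volume f J"
  note [measurable] = orlicz_volume_measurable[OF \<open>finite J\<close>]
  define \<phi> where "\<phi> a b = ?W (r - f i \<bar>a\<bar> - f j \<bar>b\<bar>)" for a b
  define m0 where "m0 a = (\<integral>\<^sup>+b. \<phi> a b \<partial>lborel)" for a
  define m2 where "m2 a = (\<integral>\<^sup>+b. ennreal (b\<^sup>2) * \<phi> a b \<partial>lborel)" for a
  have [measurable]: "case_prod \<phi> \<in> borel_measurable (borel \<Otimes>\<^sub>M borel)"
    unfolding \<phi>_def by measurable
  have [measurable]: "\<phi> a \<in> borel_measurable borel" for a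
    unfolding \<phi>_def by measurable
  have [measurable]: "m0 \<in> borel_measurable borel" "m2 \<in> borel_measurable borel"
    unfolding m0_def m2_def by measurable
  have two: "moment (\<lambda>x. h (x i) (x j)) = (\<integral>\<^sup>+a. \<integral>\<^sup>+b. h a b * \<phi> a b \<partial>lborel \<partial>lborel)"
    if "case_prod h \<in> borel_measurable (borel \<Otimes>\<^sub>M borel)" for h
    unfolding moment_def \<phi>_def I_eq by (rule nn_integral_orlicz_insert2) (use J that in auto)
  \<comment> \<open>On the left the arguments of the volume are the smallest and the largest of the four levels,
    and on the right the two intermediate ones, with the same sum.\<close>
  have rr: "\<phi> a b * \<phi> a' b' \<le> \<phi> a b' * \<phi> a' b" if "\<bar>a'\<bar> \<le> \<bar>a\<bar>" "\<bar>b'\<bar> \<le> \<bar>b\<bar>" for a b a' b'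
    unfolding \<phi>_def
    using young_abs_mono[OF young that(1), of i] young_abs_mono[OF young that(2), of j]
    by (intro orlicz_volume_four_points J) auto
  have step: "m2 a * m0 a' \<le> m2 a' * m0 a" if "a'\<^sup>2 \<le> a\<^sup>2" for a a'
  proof -
    have "(\<integral>\<^sup>+b. ennreal (b\<^sup>2) * \<phi> a b \<partial>lborel) * (\<integral>\<^sup>+b. \<phi> a' b \<partial>lborel)
      \<le> (\<integral>\<^sup>+b. \<phi> a b \<partial>lborel) * (\<integral>\<^sup>+b. ennreal (b\<^sup>2) * \<phi> a' b \<partial>lborel)"
    proof (rule chebyshev_association)
      fix b b' assume "ennreal (b'\<^sup>2) \<le> ennreal (b\<^sup>2)"
      then have "\<bar>b'\<bar> \<le> \<bar>b\<bar>" by (simp add: abs_le_square_iff)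
      moreover have "\<bar>a'\<bar> \<le> \<bar>a\<bar>" using that by (simp add: abs_le_square_iff)
      ultimately show "\<phi> a b * \<phi> a' b' \<le> \<phi> a b' * \<phi> a' b" by (intro rr)
    qed measurable
    then show ?thesis by (simp add: m0_def m2_def mult.commute)
  qed
  have "(\<integral>\<^sup>+a. ennreal (a\<^sup>2) * m2 a \<partial>lborel) * (\<integral>\<^sup>+a. m0 a \<partial>lborel)
    \<le> (\<integral>\<^sup>+a. m2 a \<partial>lborel) * (\<integral>\<^sup>+a. ennreal (a\<^sup>2) * m0 a \<partial>lborel)"
    by (rule chebyshev_association) (auto intro: step)
  moreover have "moment (\<lambda>x. ennreal ((x i)\<^sup>2) * ennreal ((x j)\<^sup>2)) = (\<integral>\<^sup>+a. ennreal (a\<^sup>2) * m2 a \<partial>lborel)"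
    by (subst two[where h = "\<lambda>a b. ennreal (a\<^sup>2) * ennreal (b\<^sup>2)"])
      (simp_all add: m2_def mult.assoc nn_integral_cmult)
  moreover have "moment (\<lambda>_. 1) = (\<integral>\<^sup>+a. m0 a \<partial>lborel)"
    by (subst two[where h = "\<lambda>a b. 1"]) (simp_all add: m0_def[abs_def])
  moreover have "moment (\<lambda>x. ennreal ((x i)\<^sup>2)) = (\<integral>\<^sup>+a. ennreal (a\<^sup>2) * m0 a \<partial>lborel)"
    by (subst two[where h = "\<lambda>a b. ennreal (a\<^sup>2)"]) (simp_all add: m0_def nn_integral_cmult)
  moreover have "moment (\<lambda>x. ennreal ((x j)\<^sup>2)) = (\<integral>\<^sup>+a. m2 a \<partial>lborel)"
    by (subst two[where h = "\<lambda>a b. ennreal (b\<^sup>2)"]) (simp_all add: m2_def[abs_def])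
  ultimately show ?thesis by (simp add: mult.commute)
qed

text \<open>
  The coordinate has density \<open>V (r - f i \<bar>a\<bar>)\<close>, where \<open>V\<close> is the volume in the other coordinates. It is
  log-concave on the half-line as the composition of an increasing log-concave function with a
  concave one.
\<close>

lemma orlicz_fourth_moment:
  fixes r :: real
  assumes I: "finite I" "i \<in> I" and "0 < v"
  defines "moment \<equiv> \<lambda>h. \<integral>\<^sup>+x. h x * indicator {..r} (\<Sum>k\<in>I. f k \<bar>x k\<bar>) \<partial>Pi\<^sub>M I (\<lambda>_. lborel)"
  assumes volume: "moment (\<lambda>_. 1) = 1" and second: "moment (\<lambda>x. ennreal ((x i)\<^sup>2)) = ennreal v"
  shows "moment (\<lambda>x. ennreal ((x i) ^ 4)) \<le> ennreal (6 * v\<^sup>2)"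
proof -
  define J where "J = I - {i}"
  have J: "finite J" "i \<notin> J" and I_eq: "I = insert i J"
    using I by (auto simp: J_def)
  define V where "V s = enn2real (orlicz_volume f J s)" for s
  define \<phi> where "\<phi> a = V (r - f i \<bar>a\<bar>)" for a
  note [measurable] = orlicz_volume_real_measurable[OF \<open>finite J\<close>]
  have [measurable]: "\<phi> \<in> borel_measurable borel"
    unfolding \<phi>_def V_def by measurable
  have pos: "0 \<le> \<phi> a" for a by (simp add: \<phi>_def V_def)
  have one: "moment (\<lambda>x. ennreal (h (x i))) = (\<integral>\<^sup>+a. ennreal (h a * \<phi> a) \<partial>lborel)"
    if [measurable]: "h \<in> borel_measurable borel" and "\<And>a. 0 \<le> h a" for h
    unfolding moment_def \<phi>_def V_def I_eq using that(2)
    by (subst nn_integral_orlicz_insert[of J i "\<lambda>a. ennreal (h a)"])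
      (simp_all add: J ennreal_mult' ennreal_orlicz_volume)
  obtain R where R: "\<And>x. f i \<bar>x\<bar> \<le> r \<Longrightarrow> \<bar>x\<bar> \<le> R"
    using young_abs_coercive[OF young] by blast
  have supp: "\<phi> a = 0" if "R < \<bar>a\<bar>" for a
    using R[of a] that orlicz_volume_eq_0[of "r - f i \<bar>a\<bar>" J]
    by (force simp: \<phi>_def V_def)
  have M0: "has_bochner_integral lborel \<phi> 1"
    using one[of "\<lambda>_. 1"] volume pos by (intro has_bochner_integral_nn_integral) auto
  have M2: "has_bochner_integral lborel (\<lambda>a. a\<^sup>2 * \<phi> a) v"
    using one[of "\<lambda>a. a\<^sup>2"] second pos \<open>0 < v\<close> by (intro has_bochner_integral_nn_integral) auto
  have int4: "integrable lborel (\<lambda>a. a ^ 4 * \<phi> a)"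
  proof (rule Bochner_Integration.integrable_bound)
    show "integrable lborel (\<lambda>a. R ^ 4 * \<phi> a)"
      using M0 by (auto simp: has_bochner_integral_iff)
    have "a ^ 4 * \<phi> a \<le> R ^ 4 * \<phi> a" for a
    proof (cases "R < \<bar>a\<bar>")
      case False
      then have "\<bar>a\<bar> ^ 4 \<le> R ^ 4" by (intro power_mono) auto
      then show ?thesis using pos by (intro mult_right_mono) auto
    qed (simp add: supp)
    then show "AE a in lborel. norm (a ^ 4 * \<phi> a) \<le> norm (R ^ 4 * \<phi> a)"
      using pos by simp
  qed measurable
  have "(\<integral>a. a ^ 4 * \<phi> a \<partial>lborel) \<le> 6 * v\<^sup>2"
  proof (rule log_concave_fourth_moment[where R = R, OF _ _ _ M0 M2])
    show "has_bochner_integral lborel (\<lambda>a. a ^ 4 * \<phi> a) (\<integral>a. a ^ 4 * \<phi> a \<partial>lborel)"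
      using int4 by (simp add: has_bochner_integral_iff)
    show "\<phi> \<bar>x\<bar> = \<phi> x" for x by (simp add: \<phi>_def)
    fix x y l :: real assume l: "0 \<le> l" "l \<le> 1"
    have "\<phi> x powr (1 - l) * \<phi> y powr l \<le> V ((1 - l) * (r - f i \<bar>x\<bar>) + l * (r - f i \<bar>y\<bar>))"
      unfolding \<phi>_def V_def
      by (rule log_concaveD[OF orlicz_volume_log_concave[OF \<open>finite J\<close>] l])
    also have "\<dots> \<le> \<phi> ((1 - l) * x + l * y)"
      unfolding \<phi>_def V_def using young_abs_convex[OF young l, of i x y]
      by (intro monoD[OF orlicz_volume_real_mono[OF \<open>finite J\<close>]])
        (simp add: algebra_simps)
    finally show "\<phi> x powr (1 - l) * \<phi> y powr l \<le> \<phi> ((1 - l) * x + l * y)" .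
  qed (use supp \<open>0 < v\<close> in auto)
  moreover have "moment (\<lambda>x. ennreal ((x i) ^ 4)) = ennreal (\<integral>a. a ^ 4 * \<phi> a \<partial>lborel)"
    using one[of "\<lambda>a. a ^ 4"] int4 pos by (simp add: nn_integral_eq_integral)
  ultimately show ?thesis by (simp add: ennreal_leI)
qed

end

section \<open>The Euclidean norm on an isotropic Orlicz ball\<close>

lemma measurable_vec_lambda_PiM [measurable]:
  "(\<lambda>w. \<chi> i. w i) \<in> Pi\<^sub>M UNIV (\<lambda>_::'n::finite. lborel :: real measure) \<rightarrow>\<^sub>M borel"
proof (subst borel_measurable_euclidean_space, intro ballI)
  fix b :: "real ^ 'n" assume "b \<in> Basis"
  then obtain i where "b = axis i 1" by (auto simp: Basis_vec_def)
  then show "(\<lambda>w. (\<chi> i. w i) \<bullet> b) \<in> borel_measurable (Pi\<^sub>M UNIV (\<lambda>_::'n. lborel :: real measure))"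
    by (simp add: inner_axis)
qed

text \<open>
  This identification allows coordinates to be integrated out one at a time, leaving a product
  measure over a smaller index set.
\<close>

lemma lborel_vec_eq_distr_PiM:
  "(lborel :: (real ^ 'n) measure) = distr (Pi\<^sub>M UNIV (\<lambda>_. lborel)) borel (\<lambda>w. \<chi> i. w i)"
proof (rule lborel_eqI)
  interpret finite_product_sigma_finite "\<lambda>_::'n. lborel :: real measure" UNIV
    by standard auto
  fix l u :: "real ^ 'n" assume le: "\<And>b. b \<in> Basis \<Longrightarrow> l \<bullet> b \<le> u \<bullet> b"
  have le': "l $ i \<le> u $ i" for i
    using le[of "axis i 1"] by (simp add: inner_axis)
  have "(\<lambda>w. \<chi> i. w i) -` box l u \<inter> space (Pi\<^sub>M UNIV (\<lambda>_::'n. lborel :: real measure))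
      = Pi\<^sub>E UNIV (\<lambda>i. {l $ i<..<u $ i})"
    by (auto simp: mem_box_cart space_PiM PiE_def Pi_def)
  then have "emeasure (distr (Pi\<^sub>M UNIV (\<lambda>_. lborel)) borel (\<lambda>w. \<chi> i. w i)) (box l u)
      = (\<Prod>i\<in>UNIV. emeasure lborel {l $ i<..<u $ i})"
    by (subst emeasure_distr) (simp_all add: measure_times)
  also have "\<dots> = (\<Prod>i\<in>UNIV. ennreal ((u - l) $ i))"
    using le' by simp
  also have "\<dots> = ennreal (\<Prod>i\<in>UNIV. (u - l) $ i)"
    using le' by (intro prod_ennreal) simp
  also have "(\<Prod>i\<in>UNIV. (u - l) $ i) = (\<Prod>b\<in>Basis. (u - l) \<bullet> b)"
  proof -
    have Basis: "Basis = (\<lambda>i. axis i (1::real)) ` (UNIV :: 'n set)"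
      by (auto simp: Basis_vec_def)
    have inj: "inj (\<lambda>i::'n. axis i (1::real))"
      by (auto simp: inj_on_def axis_eq_axis)
    show ?thesis
      unfolding Basis prod.reindex[OF inj] by (simp add: inner_axis)
  qed
  finally show "emeasure (distr (Pi\<^sub>M UNIV (\<lambda>_. lborel)) borel (\<lambda>w. \<chi> i. w i)) (box l u)
      = ennreal (\<Prod>b\<in>Basis. (u - l) \<bullet> b)" .
qed simp

text \<open>
  Expanding the square of \<open>|x|\<^sup>2 = (\<Sum>i. x\<^sub>i\<^sup>2)\<close>, each of the \<open>n\<^sup>2\<close> mixed moments contributes at most
  \<open>L\<^sup>4\<close> by negative correlation, except that the \<open>n\<close> diagonal ones may contribute \<open>5 L\<^sup>4\<close> more by the
  fourth moment bound.
\<close>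

lemma isotropic_orlicz_ball_square_norm_moment:
  fixes K :: "(real ^ 'n) set"
  assumes "generalized_orlicz_ball K" and vol: "emeasure lborel K = 1"
    and iso: "isotropic_with_constant K L"
  shows "(\<integral>\<^sup>+x. ennreal ((norm x)\<^sup>2) \<partial>uniform_measure lborel K) = ennreal (real CARD('n) * L\<^sup>2)"
    and "(\<integral>\<^sup>+x. ennreal (((norm x)\<^sup>2)\<^sup>2) \<partial>uniform_measure lborel K)
      \<le> ennreal ((real CARD('n) * L\<^sup>2)\<^sup>2 + 5 * real CARD('n) * L ^ 4)"
proof -
  let ?P = "uniform_measure lborel K"
  let ?n = "real CARD('n)"
  obtain f :: "'n \<Rightarrow> real \<Rightarrow> real" where young: "\<And>i. young_function (f i)"
    and K: "K = {x. (\<Sum>i\<in>UNIV. f i \<bar>x $ i\<bar>) \<le> 1}"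
    using assms(1) unfolding generalized_orlicz_ball_def by blast
  note [measurable] = young_measurable[of f, OF young]
  have [measurable]: "K \<in> sets borel" unfolding K by measurable
  define moment :: "(('n \<Rightarrow> real) \<Rightarrow> ennreal) \<Rightarrow> ennreal" where
    "moment h = (\<integral>\<^sup>+w. h w * indicator {..1} (\<Sum>k\<in>UNIV. f k \<bar>w k\<bar>) \<partial>Pi\<^sub>M UNIV (\<lambda>_. lborel))" for h
  have moment: "(\<integral>\<^sup>+x. h x \<partial>?P) = moment (\<lambda>w. h (\<chi> i. w i))"
    if [measurable]: "h \<in> borel_measurable borel" for h :: "real ^ 'n \<Rightarrow> ennreal"
  proof -
    have "(\<integral>\<^sup>+x. h x \<partial>?P) = (\<integral>\<^sup>+x. h x * indicator K x \<partial>lborel)"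
      using vol by (simp add: nn_integral_uniform_measure divide_ennreal_def)
    also have "\<dots> = (\<integral>\<^sup>+w. h (\<chi> i. w i) * indicator K (\<chi> i. w i) \<partial>Pi\<^sub>M UNIV (\<lambda>_. lborel))"
      by (subst lborel_vec_eq_distr_PiM) (simp add: nn_integral_distr)
    finally show ?thesis by (simp add: moment_def K indicator_def)
  qed
  have "0 < L" using iso by (simp add: isotropic_with_constant_def)
  have volume: "moment (\<lambda>_. 1) = 1"
    using moment[of "\<lambda>_. 1"] vol by (simp add: emeasure_uniform_measure)
  have second: "(\<integral>\<^sup>+x. ennreal ((x $ i)\<^sup>2) \<partial>?P) = ennreal (L\<^sup>2)" for i
  proof -
    have "(\<integral>x. (x $ i)\<^sup>2 \<partial>?P) = L\<^sup>2"
      using iso by (simp add: isotropic_with_constant_def power2_eq_square)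
    moreover from this have "integrable ?P (\<lambda>x. (x $ i)\<^sup>2)"
      using not_integrable_integral_eq[of ?P "\<lambda>x. (x $ i)\<^sup>2"] \<open>0 < L\<close> by force
    ultimately show ?thesis by (simp add: nn_integral_eq_integral)
  qed
  have diagonal: "(\<integral>\<^sup>+x. ennreal ((x $ i)\<^sup>2) * ennreal ((x $ i)\<^sup>2) \<partial>?P) \<le> ennreal (6 * (L\<^sup>2)\<^sup>2)" for i
  proof -
    have "moment (\<lambda>w. ennreal ((w i) ^ 4)) \<le> ennreal (6 * (L\<^sup>2)\<^sup>2)"
      unfolding moment_def
    proof (rule orlicz_fourth_moment[of f, OF young])
      show "(\<integral>\<^sup>+w. 1 * indicator {..1} (\<Sum>k\<in>UNIV. f k \<bar>w k\<bar>) \<partial>Pi\<^sub>M UNIV (\<lambda>_. lborel)) = 1"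
        using volume by (simp add: moment_def)
      show "(\<integral>\<^sup>+w. ennreal ((w i)\<^sup>2) * indicator {..1} (\<Sum>k\<in>UNIV. f k \<bar>w k\<bar>) \<partial>Pi\<^sub>M UNIV (\<lambda>_. lborel))
        = ennreal (L\<^sup>2)"
        using second[of i] by (simp add: moment moment_def)
    qed (use \<open>0 < L\<close> in auto)
    then show ?thesis
      by (simp add: moment flip: ennreal_mult power_add)
  qed
  have off_diagonal: "(\<integral>\<^sup>+x. ennreal ((x $ i)\<^sup>2) * ennreal ((x $ j)\<^sup>2) \<partial>?P) \<le> ennreal ((L\<^sup>2)\<^sup>2)"
    if "i \<noteq> j" for i j
  proof -
    have "moment (\<lambda>w. ennreal ((w i)\<^sup>2) * ennreal ((w j)\<^sup>2)) * moment (\<lambda>_. 1)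
      \<le> moment (\<lambda>w. ennreal ((w i)\<^sup>2)) * moment (\<lambda>w. ennreal ((w j)\<^sup>2))"
      unfolding moment_def
      by (rule orlicz_square_negative_correlation[of f, OF young]) (use that in auto)
    moreover have "moment (\<lambda>w. ennreal ((w k)\<^sup>2)) = ennreal (L\<^sup>2)" for k
      using second[of k] by (simp add: moment)
    ultimately show ?thesis
      by (simp add: moment volume flip: ennreal_mult power_add)
  qed
  have norm_sq: "(norm x)\<^sup>2 = (\<Sum>i\<in>UNIV. (x $ i)\<^sup>2)" for x :: "real ^ 'n"
    unfolding power2_norm_eq_inner inner_vec_def by (simp add: power2_eq_square)
  show "(\<integral>\<^sup>+x. ennreal ((norm x)\<^sup>2) \<partial>?P) = ennreal (?n * L\<^sup>2)"
  proof -
    have "(\<integral>\<^sup>+x. ennreal ((norm x)\<^sup>2) \<partial>?P) = (\<integral>\<^sup>+x. (\<Sum>i\<in>UNIV. ennreal ((x $ i)\<^sup>2)) \<partial>?P)"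
      by (intro nn_integral_cong) (simp add: norm_sq sum_ennreal)
    also have "\<dots> = (\<Sum>i\<in>(UNIV::'n set). ennreal (L\<^sup>2))"
      by (subst nn_integral_sum) (simp_all only: second, measurable)
    also have "\<dots> = ennreal (?n * L\<^sup>2)"
      by (subst sum_ennreal) simp_all
    finally show ?thesis .
  qed
  have "(\<integral>\<^sup>+x. ennreal (((norm x)\<^sup>2)\<^sup>2) \<partial>?P)
      = (\<integral>\<^sup>+x. (\<Sum>i\<in>UNIV. \<Sum>j\<in>UNIV. ennreal ((x $ i)\<^sup>2) * ennreal ((x $ j)\<^sup>2)) \<partial>?P)"
  proof (rule nn_integral_cong)
    fix x :: "real ^ 'n"
    have "((norm x)\<^sup>2)\<^sup>2 = (\<Sum>i\<in>UNIV. \<Sum>j\<in>UNIV. (x $ i)\<^sup>2 * (x $ j)\<^sup>2)"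
      by (simp add: norm_sq power2_eq_square[of "sum _ _"] sum_product)
    then show "ennreal (((norm x)\<^sup>2)\<^sup>2) = (\<Sum>i\<in>UNIV. \<Sum>j\<in>UNIV. ennreal ((x $ i)\<^sup>2) * ennreal ((x $ j)\<^sup>2))"
      by (simp add: sum_ennreal sum_nonneg flip: ennreal_mult)
  qed
  also have "\<dots> = (\<Sum>i\<in>UNIV. \<Sum>j\<in>UNIV. \<integral>\<^sup>+x. ennreal ((x $ i)\<^sup>2) * ennreal ((x $ j)\<^sup>2) \<partial>?P)"
    by (simp add: nn_integral_sum)
  also have "\<dots> \<le> (\<Sum>i\<in>(UNIV::'n set). \<Sum>j\<in>(UNIV::'n set). ennreal ((L\<^sup>2)\<^sup>2 + (if i = j then 5 * (L\<^sup>2)\<^sup>2 else 0)))"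
    using diagonal off_diagonal by (intro sum_mono) (auto simp del: ennreal_plus)
  also have "\<dots> = ennreal (\<Sum>i\<in>(UNIV::'n set). \<Sum>j\<in>(UNIV::'n set). (L\<^sup>2)\<^sup>2 + (if i = j then 5 * (L\<^sup>2)\<^sup>2 else 0))"
    by (simp add: sum_ennreal sum_nonneg del: ennreal_plus)
  also have "(\<Sum>i\<in>(UNIV::'n set). \<Sum>j\<in>(UNIV::'n set). (L\<^sup>2)\<^sup>2 + (if i = j then 5 * (L\<^sup>2)\<^sup>2 else 0))
      = (?n * L\<^sup>2)\<^sup>2 + 5 * ?n * L ^ 4"
    by (simp add: sum.distrib sum.delta power2_eq_square power4_eq_xxxx algebra_simps)
  finally show "(\<integral>\<^sup>+x. ennreal (((norm x)\<^sup>2)\<^sup>2) \<partial>?P) \<le> ennreal ((?n * L\<^sup>2)\<^sup>2 + 5 * ?n * L ^ 4)" .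
qed

section \<open>Concentration\<close>

theorem corollary4p2:
  fixes K :: "(real ^ 'n) set" and M :: "'a measure" and X :: "'a \<Rightarrow> real ^ 'n" and t :: real
  assumes "generalized_orlicz_ball K"
    and "emeasure lborel K = 1"
    and "isotropic_position K"
    and "prob_space M"
    and "uniformly_distributed M X K"
    and "t > 0"
  shows "\<P>(\<omega> in M. \<bar>(norm (X \<omega>))\<^sup>2 / real CARD('n) - (isotropic_constant K)\<^sup>2\<bar> \<ge> t)
           \<le> 5 * isotropic_constant K ^ 4 / (real CARD('n) * t\<^sup>2)
       \<and> \<P>(\<omega> in M. \<bar>norm (X \<omega>) / sqrt (real CARD('n)) - isotropic_constant K\<bar> \<ge> t)
           \<le> 5 * (isotropic_constant K)\<^sup>2 / (real CARD('n) * t\<^sup>2)"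
proof -
  interpret prob_space M by fact
  obtain L where iso: "isotropic_with_constant K L"
    using assms(3) by (auto simp: isotropic_position_def)
  then have "0 < L" and L: "isotropic_constant K = L"
    by (simp_all add: isotropic_with_constant_def isotropic_constant_eq)
  let ?n = "real CARD('n)"
  have n: "0 < ?n" by simp
  have [measurable]: "X \<in> borel_measurable M" and X: "distr M borel X = uniform_measure lborel K"
    using assms(5) by (auto simp: uniformly_distributed_def)
  define Y where "Y \<omega> = (norm (X \<omega>))\<^sup>2" for \<omega>
  have [measurable]: "Y \<in> borel_measurable M" unfolding Y_def by measurable
  note moments = isotropic_orlicz_ball_square_norm_moment[OF assms(1,2) iso]
  have "(\<integral>\<^sup>+\<omega>. ennreal (Y \<omega>) \<partial>M) = ennreal (?n * L\<^sup>2)"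
    using moments(1) by (simp add: X[symmetric] nn_integral_distr Y_def)
  then have "has_bochner_integral M Y (?n * L\<^sup>2)"
    by (intro has_bochner_integral_nn_integral) (auto simp: Y_def)
  then have int1: "integrable M Y" and mean: "expectation Y = ?n * L\<^sup>2"
    by (auto simp: has_bochner_integral_iff)
  have sq: "(\<integral>\<^sup>+\<omega>. ennreal ((Y \<omega>)\<^sup>2) \<partial>M) \<le> ennreal ((?n * L\<^sup>2)\<^sup>2 + 5 * ?n * L ^ 4)"
    using moments(2) by (simp add: X[symmetric] nn_integral_distr Y_def)
  then have int2: "integrable M (\<lambda>\<omega>. (Y \<omega>)\<^sup>2)"
    by (intro integrableI_nonneg) (auto intro: le_less_trans)
  have "ennreal (expectation (\<lambda>\<omega>. (Y \<omega>)\<^sup>2)) \<le> ennreal ((?n * L\<^sup>2)\<^sup>2 + 5 * ?n * L ^ 4)"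
    using sq int2 by (simp add: nn_integral_eq_integral del: ennreal_plus)
  then have "expectation (\<lambda>\<omega>. (Y \<omega>)\<^sup>2) \<le> (?n * L\<^sup>2)\<^sup>2 + 5 * ?n * L ^ 4"
    by (subst (asm) ennreal_le_iff) auto
  then have var: "variance Y \<le> 5 * ?n * L ^ 4"
    using variance_eq[OF int1 int2] unfolding mean by linarith
  have tail: "\<P>(\<omega> in M. \<bar>Y \<omega> / ?n - L\<^sup>2\<bar> \<ge> s) \<le> 5 * L ^ 4 / (?n * s\<^sup>2)" if "0 < s" for s
  proof -
    have "\<bar>Y \<omega> / ?n - L\<^sup>2\<bar> \<ge> s \<longleftrightarrow> \<bar>Y \<omega> - ?n * L\<^sup>2\<bar> \<ge> ?n * s" for \<omega>
    proof -
      have "\<bar>Y \<omega> - ?n * L\<^sup>2\<bar> = \<bar>?n * (Y \<omega> / ?n - L\<^sup>2)\<bar>"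
        by (simp add: right_diff_distrib)
      then show ?thesis by (simp add: abs_mult)
    qed
    then have "\<P>(\<omega> in M. \<bar>Y \<omega> / ?n - L\<^sup>2\<bar> \<ge> s) = \<P>(\<omega> in M. \<bar>Y \<omega> - expectation Y\<bar> \<ge> ?n * s)"
      by (simp add: mean)
    also have "\<dots> \<le> variance Y / (?n * s)\<^sup>2"
      using that by (intro Chebyshev_inequality int2) auto
    also have "\<dots> \<le> (5 * ?n * L ^ 4) / (?n * s)\<^sup>2"
      by (intro divide_right_mono var) auto
    also have "\<dots> = 5 * L ^ 4 / (?n * s\<^sup>2)"
      by (simp add: power2_eq_square)
    finally show ?thesis .
  qed
  have "\<P>(\<omega> in M. \<bar>norm (X \<omega>) / sqrt ?n - L\<bar> \<ge> t) \<le> \<P>(\<omega> in M. \<bar>Y \<omega> / ?n - L\<^sup>2\<bar> \<ge> t * L)"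
  proof (rule finite_measure_mono)
    have "t * L \<le> \<bar>Y \<omega> / ?n - L\<^sup>2\<bar>" if "t \<le> \<bar>norm (X \<omega>) / sqrt ?n - L\<bar>" for \<omega>
    proof -
      let ?z = "norm (X \<omega>) / sqrt ?n"
      have "t * L \<le> \<bar>?z - L\<bar> * (?z + L)"
        using that \<open>0 < L\<close> \<open>t > 0\<close> by (intro mult_mono) auto
      also have "\<dots> = \<bar>(?z - L) * (?z + L)\<bar>"
        using \<open>0 < L\<close> by (simp add: abs_mult)
      also have "(?z - L) * (?z + L) = ?z\<^sup>2 - L\<^sup>2"
        by (simp add: power2_eq_square algebra_simps)
      also have "?z\<^sup>2 = Y \<omega> / ?n"
        by (simp add: Y_def power_divide)
      finally show ?thesis .
    qed
    then show "{\<omega> \<in> space M. \<bar>norm (X \<omega>) / sqrt ?n - L\<bar> \<ge> t} \<subseteq> {\<omega> \<in> space M. \<bar>Y \<omega> / ?n - L\<^sup>2\<bar> \<ge> t * L}"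
      by auto
  qed measurable
  also have "\<dots> \<le> 5 * L ^ 4 / (?n * (t * L)\<^sup>2)"
    using \<open>0 < L\<close> \<open>t > 0\<close> by (intro tail) simp
  also have "\<dots> = 5 * L\<^sup>2 / (?n * t\<^sup>2)"
    using \<open>0 < L\<close> by (simp add: power2_eq_square power4_eq_xxxx)
  finally show ?thesis
    using tail[OF \<open>t > 0\<close>] by (simp add: L Y_def)
qed

end
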